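(* Let $\mathcal C$ be a category of partitions which is hyperoctahedral and not group-theoretical. Then either $\mathcal C=\langle \pi_l,\ l\le k\rangle$ for some $k\in\mathbb N$, or $\mathcal C=\langle \pi_l,\ l\in\mathbb N\rangle$.
   Context: $\mathbb N=\{1,2,\dots\}$, $\mathbb N_0=\mathbb N\cup\{0\}$. For $k,l\in\mathbb N_0$, a partition $p\in P(k,l)$ is a decomposition of a set of $k$ upper points $1,\dots,k$ and $l$ lower points $1',\dots,l'$ (each row ordered from left to right) into disjoint nonempty subsets, called blocks; $P=\bigsqcup_{k,l}P(k,l)$. Category operations: the tensor product $p\otimes q\in P(k+k',l+l')$ of $p\in P(k,l)$, $q\in P(k',l')$ is horizontal concatenation; the composition $qp\in P(k,m)$ of $p\in P(k,l)$, $q\in P(l,m)$ is vertical concatenation ($p$ above $q$, identifying the lower points of $p$ with the upper points of $q$, taking the generated connections between the remaining points, and deleting the middle points and any closed components consisting only of middle points); the involution $p^*\in P(l,k)$ turns $p$ upside down; rotation moves the leftmost (resp. rightmost) point of one row to the leftmost (resp. rightmost) position of the other row, keeping it in its block. A category of partitions is a subset $\mathcal C\subseteq P$ closed under these operations and containing the identity partition $|\in P(1,1)$ (one upper point connected to one lower point). $\langle p_1,p_2,\dots\rangle$ denotes the smallest category of partitions containing $p_1,p_2,\dots$. A partition in $P(0,n)$ is identified with a word of length $n$, positions carrying the same letter iff they lie in the same block (distinct blocks get distinct letters). Special partitions: the four block partition is the word $aaaa\in P(0,4)$; the double singleton is the word $ab\in P(0,2)$ (two unconnected lower points); the pair positioner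 partition is the partition in $P(3,3)$ with blocks $\{1,2,2',3'\}$ and $\{3,1'\}$. For $k\in\mathbb N$, $\pi_k\in P(0,4k)$ is the word $a_1a_2\ldots a_ka_k\ldots a_2a_1a_1a_2\ldots a_ka_k\ldots a_2a_1$ with mutually different letters $a_1,\dots,a_k$. A category $\mathcal C$ is hyperoctahedral if it contains the four block partition but not the double singleton; it is group-theoretical if it contains the pair positioner partition. *)

theory Defs
  imports "HOL.Hull" "HOL-Library.Disjoint_Sets"
begin

text \<open>Points of each row are numbered from 1, left to right.\<close>

datatype point = Upper nat | Lower nat

datatype partition = Partition (uppers: nat) (lowers: nat) (blocks: "point set set")

definition points :: "nat \<Rightarrow> nat \<Rightarrow> point set" where
  "points k l = Upper ` {1..k} \<union> Lower ` {1..l}"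

definition partitions :: "nat \<Rightarrow> nat \<Rightarrow> partition set" where
  "partitions k l = {Partition k l B | B. partition_on (points k l) B}"

definition all_partitions :: "partition set" where
  "all_partitions = (\<Union>k l. partitions k l)"


subsection \<open>Category operations\<close>

fun shift_point :: "nat \<Rightarrow> nat \<Rightarrow> point \<Rightarrow> point" where
  "shift_point k l (Upper i) = Upper (k + i)"
| "shift_point k l (Lower j) = Lower (l + j)"

definition tensor :: "partition \<Rightarrow> partition \<Rightarrow> partition" where
  "tensor p q = Partition (uppers p + uppers q) (lowers p + lowers q)
     (blocks p \<union> (`) (shift_point (uppers p) (lowers p)) ` blocks q)"

fun flip_point :: "point \<Rightarrow> point" where
  "flip_point (Upper i) = Lower i"
| "flip_point (Lower j) = Upper j"

definition involution :: "partition \<Rightarrow> partition" where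
  "involution p = Partition (lowers p) (uppers p) ((`) flip_point ` blocks p)"

text \<open>
  For the composition, \<open>p\<close> is drawn above \<open>q\<close>. The lower points of \<open>p\<close> and the upper points
  of \<open>q\<close> both become the middle points of the resulting three-row diagram.
\<close>

datatype diagram_point = Top nat | Mid nat | Bot nat

fun in_upper_half :: "point \<Rightarrow> diagram_point" where
  "in_upper_half (Upper i) = Top i"
| "in_upper_half (Lower j) = Mid j"

fun in_lower_half :: "point \<Rightarrow> diagram_point" where
  "in_lower_half (Upper i) = Mid i"
| "in_lower_half (Lower j) = Bot j"

fun outer_point :: "point \<Rightarrow> diagram_point" where
  "outer_point (Upper i) = Top i"
| "outer_point (Lower j) = Bot j"

definition joined :: "partition \<Rightarrow> partition \<Rightarrow> diagram_point rel" where
  "joined p q = (\<Union>b\<in>blocks p. in_upper_half ` b \<times> in_upper_half ` b)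
              \<union> (\<Union>b\<in>blocks q. in_lower_half ` b \<times> in_lower_half ` b)"

text \<open>
  \<open>joined p q\<close> is symmetric, and reflexive on the points of the diagram, so its transitive closure
  is the generated equivalence relation. Taking preimages under \<^const>\<open>outer_point\<close> deletes the
  middle points from its classes; the classes consisting only of middle points become empty.
  The order of the arguments is that of the product \<open>qp\<close>, which is only meaningful
  if \<^term>\<open>lowers p = uppers q\<close>.
\<close>

definition compose :: "partition \<Rightarrow> partition \<Rightarrow> partition" where
  "compose q p = Partition (uppers p) (lowers q)
     ((-`) outer_point ` (Field (joined p q) // (joined p q)\<^sup>+) - {{}})"

text \<open>
  Each rotation is only meaningful if the row the point is taken from is nonempty.
\<close>

fun rot_point_left_down :: "point \<Rightarrow> point" where
  "rot_point_left_down (Upper i) = (if i = 1 then Lower 1 else Upper (i - 1))"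
| "rot_point_left_down (Lower j) = Lower (j + 1)"

fun rot_point_left_up :: "point \<Rightarrow> point" where
  "rot_point_left_up (Upper i) = Upper (i + 1)"
| "rot_point_left_up (Lower j) = (if j = 1 then Upper 1 else Lower (j - 1))"

definition rotate_left_down :: "partition \<Rightarrow> partition" where
  "rotate_left_down p = Partition (uppers p - 1) (lowers p + 1)
     ((`) rot_point_left_down ` blocks p)"

definition rotate_left_up :: "partition \<Rightarrow> partition" where
  "rotate_left_up p = Partition (uppers p + 1) (lowers p - 1)
     ((`) rot_point_left_up ` blocks p)"

definition rotate_right_down :: "partition \<Rightarrow> partition" where
  "rotate_right_down p = Partition (uppers p - 1) (lowers p + 1)
     ((`) (id(Upper (uppers p) := Lower (lowers p + 1))) ` blocks p)"

definition rotate_right_up :: "partition \<Rightarrow> partition" where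
  "rotate_right_up p = Partition (uppers p + 1) (lowers p - 1)
     ((`) (id(Lower (lowers p) := Upper (uppers p + 1))) ` blocks p)"


subsection \<open>Categories of partitions\<close>

definition id_partition :: partition where
  "id_partition = Partition 1 1 {{Upper 1, Lower 1}}"

definition partition_category :: "partition set \<Rightarrow> bool" where
  "partition_category C \<longleftrightarrow>
     C \<subseteq> all_partitions \<and>
     id_partition \<in> C \<and>
     (\<forall>p\<in>C. \<forall>q\<in>C. tensor p q \<in> C) \<and>
     (\<forall>p\<in>C. \<forall>q\<in>C. lowers p = uppers q \<longrightarrow> compose q p \<in> C) \<and>
     (\<forall>p\<in>C. involution p \<in> C) \<and>
     (\<forall>p\<in>C. 0 < uppers p \<longrightarrow> rotate_left_down p \<in> C \<and> rotate_right_down p \<in> C) \<and>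
     (\<forall>p\<in>C. 0 < lowers p \<longrightarrow> rotate_left_up p \<in> C \<and> rotate_right_up p \<in> C)"

definition generated_category :: "partition set \<Rightarrow> partition set" where
  "generated_category S = partition_category hull S"


subsection \<open>Special partitions\<close>

definition word_partition :: "'a list \<Rightarrow> partition" where
  "word_partition w = Partition 0 (length w)
     ((\<lambda>a. {Lower (i + 1) | i. i < length w \<and> w ! i = a}) ` set w)"

definition four_block :: partition where
  "four_block = word_partition [0::nat, 0, 0, 0]"

definition double_singleton :: partition where
  "double_singleton = word_partition [0::nat, 1]"

definition pair_positioner :: partition where
  "pair_positioner = Partition 3 3
     {{Upper 1, Upper 2, Lower 2, Lower 3}, {Upper 3, Lower 1}}"

definition pi_partition :: "nat \<Rightarrow> partition" where
  "pi_partition k = (let w = [1..<k + 1] in word_partition (w @ rev w @ w @ rev w))"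

definition hyperoctahedral :: "partition set \<Rightarrow> bool" where
  "hyperoctahedral C \<longleftrightarrow> four_block \<in> C \<and> double_singleton \<notin> C"

definition group_theoretical :: "partition set \<Rightarrow> bool" where
  "group_theoretical C \<longleftrightarrow> pair_positioner \<in> C"

end

theory Submission
  imports Defs
begin

text \<open>
  Up to rotation a category is a set of words closed under renaming of letters, cyclic rotation,
  reversal, concatenation and contraction of two neighbouring letters (which are deleted and
  identified elsewhere). Read letters as involutions. If \<open>C\<close> is hyperoctahedral and not
  group-theoretical, every word of \<open>C\<close> is a closed walk on a tree whose edges are labelled by distinct
  letters: it freely reduces to the empty word, and so does the part between two consecutive
  occurrences of a letter. A failure of this could be contracted to a word \<open>abav\<close>
  with \<open>a \<noteq> b\<close>, from which the double singleton or the pair positioner arises.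

  The theorem follows once \<open>C \<subseteq> D\<close> is known for every category \<open>D\<close> containing all the \<open>\<pi>\<^sub>j\<close>
  which lie in \<open>C\<close>. By induction on the length, let \<open>w = ccxcy\<close> be a word of \<open>C\<close>
  in which the distance between a turn \<open>cc\<close> and the next letter \<open>c\<close> is minimal. Gluing \<open>w\<close> with its
  mirror image along \<open>y\<close> gives the word \<open>ccxccx\<^sup>-\<^sup>1\<close> of \<open>C\<close>, and \<open>w\<close> is recovered from this
  word and the shorter word \<open>xcy\<close> by gluing along \<open>xc\<close>. To see that \<open>ccxccx\<^sup>-\<^sup>1\<close> is in \<open>D\<close>,
  let \<open>dd\<close> be the first turn of \<open>x = gddx'\<close>; its mirror image can be deleted, and it is restored by
  some \<open>\<pi>\<^sub>j\<close> in \<open>C\<close>, because the walk runs four times through the path \<open>cgd\<close>.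
\<close>

subsection \<open>Partitions as pairs of words\<close>

definition kernel_partition :: "'a set \<Rightarrow> ('a \<Rightarrow> 'b) \<Rightarrow> 'a set set" where
  "kernel_partition A f = (\<lambda>x. {y \<in> A. f y = f x}) ` A"

lemma kernel_partition_image:
  assumes "\<And>x. x \<in> A \<Longrightarrow> g (\<phi> x) = f x"
  shows "(`) \<phi> ` kernel_partition A f = kernel_partition (\<phi> ` A) g"
proof -
  have "\<phi> ` {y \<in> A. f y = f x} = {z \<in> \<phi> ` A. g z = g (\<phi> x)}" if "x \<in> A" for x
    using assms that by auto
  then show ?thesis
    unfolding kernel_partition_def image_image by (intro image_cong) auto
qed

lemma kernel_partition_cong:
  assumes "A = B" "\<And>x y. x \<in> A \<Longrightarrow> y \<in> A \<Longrightarrow> f x = f y \<longleftrightarrow> g x = g y"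
  shows "kernel_partition A f = kernel_partition B g"
  unfolding kernel_partition_def using assms by (intro image_cong) auto

lemma kernel_partition_Un:
  assumes "\<And>x y. x \<in> A \<Longrightarrow> y \<in> B \<Longrightarrow> f x \<noteq> f y"
  shows "kernel_partition (A \<union> B) f = kernel_partition A f \<union> kernel_partition B f"
proof -
  have "{y \<in> A \<union> B. f y = f x} = {y \<in> A. f y = f x}" if "x \<in> A" for x
    using assms that by force
  moreover have "{y \<in> A \<union> B. f y = f x} = {y \<in> B. f y = f x}" if "x \<in> B" for x
    using assms that by force
  ultimately show ?thesis unfolding kernel_partition_def image_Un by simp
qed

lemma kernel_partition_vimage:
  "(-`) \<phi> ` kernel_partition A f - {{}} = kernel_partition (\<phi> -` A) (f \<circ> \<phi>)"
proof
  show "(-`) \<phi> ` kernel_partition A f - {{}} \<subseteq> kernel_partition (\<phi> -` A) (f \<circ> \<phi>)"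
  proof
    fix b assume "b \<in> (-`) \<phi> ` kernel_partition A f - {{}}"
    then obtain x where x: "x \<in> A" "b = \<phi> -` {y \<in> A. f y = f x}" "b \<noteq> {}"
      unfolding kernel_partition_def by auto
    then obtain z where z: "\<phi> z \<in> A" "f (\<phi> z) = f x" by auto
    then have "b = {y \<in> \<phi> -` A. (f \<circ> \<phi>) y = (f \<circ> \<phi>) z}" using x by auto
    with z show "b \<in> kernel_partition (\<phi> -` A) (f \<circ> \<phi>)"
      unfolding kernel_partition_def by blast
  qed
  show "kernel_partition (\<phi> -` A) (f \<circ> \<phi>) \<subseteq> (-`) \<phi> ` kernel_partition A f - {{}}"
  proof
    fix b assume "b \<in> kernel_partition (\<phi> -` A) (f \<circ> \<phi>)"
    then obtain z where z: "\<phi> z \<in> A" "b = {y. \<phi> y \<in> A \<and> f (\<phi> y) = f (\<phi> z)}"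
      unfolding kernel_partition_def by auto
    then have "b = \<phi> -` {y \<in> A. f y = f (\<phi> z)}" "z \<in> b" by auto
    with z show "b \<in> (-`) \<phi> ` kernel_partition A f - {{}}"
      unfolding kernel_partition_def by blast
  qed
qed

text \<open>The inclusion bounds \<open>r\<^sup>+\<close> from above, connectedness from below; the
  pairs \<open>(x, x)\<close> give \<open>Field r = A\<close>. This computes the classes of a
  three-row diagram.\<close>

lemma quotient_trancl_eq_kernel_partition:
  assumes sub: "r \<subseteq> {(x, y). x \<in> A \<and> y \<in> A \<and> f x = f y}"
    and conn: "\<And>x y. x \<in> A \<Longrightarrow> y \<in> A \<Longrightarrow> f x = f y \<Longrightarrow> (x, y) \<in> r\<^sup>+"
  shows "Field r // r\<^sup>+ = kernel_partition A f"
proof -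
  let ?E = "{(x, y). x \<in> A \<and> y \<in> A \<and> f x = f y}"
  have "r\<^sup>+ \<subseteq> ?E\<^sup>+" using trancl_mono[OF _ sub] by auto
  also have "\<dots> = ?E" by (rule trancl_id) (auto intro!: transI)
  finally have rE: "r\<^sup>+ = ?E" using conn by auto
  have "Field r = A"
  proof
    show "Field r \<subseteq> A" using sub by (auto simp: Field_def)
    have "A \<subseteq> Domain (r\<^sup>+)" unfolding rE by auto
    then show "A \<subseteq> Field r" unfolding trancl_domain by (auto simp: Field_def)
  qed
  then show ?thesis
    unfolding rE quotient_def kernel_partition_def
    by (auto simp: Image_def intro!: image_cong) (auto simp: eq_commute image_iff)
qed

fun row_label :: "'a list \<Rightarrow> 'a list \<Rightarrow> point \<Rightarrow> 'a" where
  "row_label u v (Upper i) = u ! (i - 1)"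
| "row_label u v (Lower j) = v ! (j - 1)"

text \<open>The upper row is labelled by \<^term>\<open>u\<close>, the lower row by \<^term>\<open>v\<close>; equal letters, also across rows,
  mark points of the same block.\<close>

definition two_row :: "'a list \<Rightarrow> 'a list \<Rightarrow> partition" where
  "two_row u v = Partition (length u) (length v)
     (kernel_partition (points (length u) (length v)) (row_label u v))"

lemma two_row_sel [simp]:
  "uppers (two_row u v) = length u" "lowers (two_row u v) = length v"
  "blocks (two_row u v) = kernel_partition (points (length u) (length v)) (row_label u v)"
  by (simp_all add: two_row_def)

lemma points_eq_Suc:
  "points k l = (\<lambda>i. Upper (Suc i)) ` {..<k} \<union> (\<lambda>i. Lower (Suc i)) ` {..<l}"
  proof -
  have "{1..n} = Suc ` {..<n}" for n by (simp add: image_Suc_lessThan)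
  then show ?thesis by (simp only: points_def image_image)
qed

lemma word_partition_eq_two_row: "word_partition w = two_row [] w"
proof -
  have "{y \<in> points 0 (length w). row_label [] w y = a} = {Lower (i + 1) | i. i < length w \<and> w ! i = a}"
    for a by (auto simp: points_eq_Suc)
  moreover have "set w = row_label [] w ` points 0 (length w)"
    by (auto simp: points_eq_Suc image_image set_conv_nth)
  ultimately show ?thesis
    unfolding word_partition_def two_row_def kernel_partition_def by (simp add: image_image)
qed

lemma two_row_map:
  assumes "inj_on f (set u \<union> set v)"
  shows "two_row (map f u) (map f v) = two_row u v"
proof -
  let ?A = "points (length u) (length v)"
  have "row_label (map f u) (map f v) x = f (row_label u v x)"
    "row_label u v x \<in> set u \<union> set v" if "x \<in> ?A" for x
    using that by (auto simp: points_eq_Suc)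
  then show ?thesis unfolding two_row_def length_map
    using inj_on_eq_iff[OF assms] by (auto intro!: kernel_partition_cong)
qed

lemma word_partition_map: "inj_on f (set w) \<Longrightarrow> word_partition (map f w) = word_partition w"
  using two_row_map[of f "[]" w] by (simp add: word_partition_eq_two_row)

section \<open>Category operations in terms of row labels\<close>

lemma two_row_image:
  assumes "\<And>x. x \<in> points (length u) (length v) \<Longrightarrow> row_label u' v' (\<phi> x) = row_label u v x"
    and "\<phi> ` points (length u) (length v) = points (length u') (length v')"
  shows "(`) \<phi> ` blocks (two_row u v) = blocks (two_row u' v')"
  using kernel_partition_image[of "points (length u) (length v)" "row_label u' v'" \<phi>] assms by simp

lemma rotate_left_down_two_row: "rotate_left_down (two_row (a # u) v) = two_row u (a # v)"
proof -
  have "(`) rot_point_left_down ` blocks (two_row (a # u) v) = blocks (two_row u (a # v))"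
    by (rule two_row_image)
      (auto simp: points_eq_Suc nth_Cons' image_Un image_image lessThan_Suc_eq_insert_0)
  then show ?thesis by (simp add: rotate_left_down_def two_row_def)
qed

lemma rotate_left_up_two_row: "rotate_left_up (two_row u (a # v)) = two_row (a # u) v"
proof -
  have "(`) rot_point_left_up ` blocks (two_row u (a # v)) = blocks (two_row (a # u) v)"
    by (rule two_row_image)
      (auto simp: points_eq_Suc nth_Cons' image_Un image_image lessThan_Suc_eq_insert_0)
  then show ?thesis by (simp add: rotate_left_up_def two_row_def)
qed

lemma rotate_right_down_two_row: "rotate_right_down (two_row (u @ [a]) v) = two_row u (v @ [a])"
proof -
  let ?\<phi> = "id(Upper (length (u @ [a])) := Lower (length v + 1))"
  have "(`) ?\<phi> ` blocks (two_row (u @ [a]) v) = blocks (two_row u (v @ [a]))"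
  proof (rule two_row_image)
    show "row_label u (v @ [a]) (?\<phi> x) = row_label (u @ [a]) v x"
      if "x \<in> points (length (u @ [a])) (length v)" for x
      using that by (auto simp: points_eq_Suc nth_append less_Suc_eq)
    have "(\<lambda>i. ?\<phi> (Upper (Suc i))) ` {..<length u} = (\<lambda>i. Upper (Suc i)) ` {..<length u}"
      "(\<lambda>i. ?\<phi> (Lower (Suc i))) ` {..<length v} = (\<lambda>i. Lower (Suc i)) ` {..<length v}"
      by (auto intro!: image_cong)
    then show "?\<phi> ` points (length (u @ [a])) (length v) = points (length u) (length (v @ [a]))"
      by (auto simp: points_eq_Suc image_Un image_image lessThan_Suc)
  qed
  then show ?thesis by (simp add: rotate_right_down_def two_row_def)
qed

lemma involution_two_row: "involution (two_row u v) = two_row v u"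
proof -
  have "(`) flip_point ` blocks (two_row u v) = blocks (two_row v u)"
    by (rule two_row_image) (auto simp: points_eq_Suc image_Un image_image)
  then show ?thesis by (simp add: involution_def two_row_def)
qed

lemma tensor_word_partition:
  assumes "set u \<inter> set v = {}"
  shows "tensor (two_row [] u) (two_row [] v) = two_row [] (u @ v)"
proof -
  let ?U = "points 0 (length u)" and ?V = "points 0 (length v)" and ?W = "points 0 (length (u @ v))"
  let ?s = "shift_point 0 (length u)"
  let ?f = "row_label [] (u @ v)"
  have fU: "?f x = row_label [] u x" "?f x \<in> set u" if "x \<in> ?U" for x
    using that by (auto simp: points_eq_Suc nth_append)
  have fV: "?f (?s x) = row_label [] v x" "?f (?s x) \<in> set v" if "x \<in> ?V" for x
    using that by (auto simp: points_eq_Suc nth_append)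
  have sep: "?f x \<noteq> ?f (?s y)" if "x \<in> ?U" "y \<in> ?V" for x y
    using fU(2)[OF that(1)] fV(2)[OF that(2)] assms by (metis disjoint_iff)
  have W: "?W = ?U \<union> ?s ` ?V"
  proof -
    have "{..<length u + length v} = {..<length u} \<union> (+) (length u) ` {..<length v}"
      by (auto simp: image_add_atLeastLessThan lessThan_atLeast0 simp del: image_add_atLeastLessThan')
    then show ?thesis by (simp only: points_eq_Suc image_Un image_image length_append) simp
  qed
  have "blocks (two_row [] (u @ v)) = kernel_partition ?W ?f" by simp
  also have "\<dots> = kernel_partition ?U ?f \<union> kernel_partition (?s ` ?V) ?f"
    unfolding W using sep by (intro kernel_partition_Un) blast
  also have "kernel_partition ?U ?f = kernel_partition ?U (row_label [] u)"
    by (rule kernel_partition_cong) (simp_all add: fU(1))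
  also have "kernel_partition (?s ` ?V) ?f = (`) ?s ` kernel_partition ?V (row_label [] v)"
    by (rule kernel_partition_image[symmetric]) (rule fV(1))
  finally show ?thesis by (simp add: tensor_def two_row_def)
qed

text \<open>There are finitely many blocks, numbered injectively by \<open>h\<close>; a point is
  labelled with the number of its block.\<close>

lemma partition_as_two_row:
  assumes "p \<in> all_partitions"
  obtains u v :: "nat list" where "p = two_row u v"
proof -
  from assms obtain k l B where p: "p = Partition k l B" and B: "partition_on (points k l) B"
    by (auto simp: all_partitions_def partitions_def)
  have "finite (points k l)" by (simp add: points_eq_Suc)
  then have "finite B" using B by (simp add: finite_elements)
  then obtain h :: "point set \<Rightarrow> nat" where h: "inj_on h B" by (metis finite_imp_inj_to_nat_seg)
  define f where "f x = h (THE b. b \<in> B \<and> x \<in> b)" for x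
  have uniq: "b = b'" if "b \<in> B" "b' \<in> B" "x \<in> b" "x \<in> b'" for x b b'
    using disjointD[OF partition_onD2[OF B] that(1,2)] that(3,4) by auto
  have fb: "f x = h b" if "b \<in> B" "x \<in> b" for x b
  proof -
    have "(THE b. b \<in> B \<and> x \<in> b) = b"
    proof (rule the_equality)
      show "b \<in> B \<and> x \<in> b" using that by simp
      show "b' = b" if "b' \<in> B \<and> x \<in> b'" for b'
        using uniq[of b' b x] that \<open>b \<in> B\<close> \<open>x \<in> b\<close> by simp
    qed
    then show ?thesis by (simp add: f_def)
  qed
  have U: "\<Union>B = points k l" using B by (simp add: partition_on_def)
  have blk: "{y \<in> points k l. f y = f x} = b" if "b \<in> B" "x \<in> b" for x b
  proof -
    have "f y = f x \<longleftrightarrow> y \<in> b" if y: "y \<in> points k l" for y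
    proof -
      obtain b' where b': "b' \<in> B" "y \<in> b'" using y U by blast
      then have "f y = f x \<longleftrightarrow> b' = b"
        using fb[of b' y] fb[of b x] \<open>b \<in> B\<close> \<open>x \<in> b\<close> inj_on_eq_iff[OF h, of b' b] by simp
      also have "\<dots> \<longleftrightarrow> y \<in> b"
        using b' \<open>b \<in> B\<close> uniq[of b' b y] by auto
      finally show ?thesis .
    qed
    moreover have "b \<subseteq> points k l" using \<open>b \<in> B\<close> U by blast
    ultimately show ?thesis by blast
  qed
  have "B = kernel_partition (points k l) f"
  proof (rule set_eqI)
    fix b
    show "b \<in> B \<longleftrightarrow> b \<in> kernel_partition (points k l) f"
    proof
      assume b: "b \<in> B"
      then have "b \<noteq> {}" using partition_onD3[OF B] by metis
      then obtain x where x: "x \<in> b" by blast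
      then have "x \<in> points k l" using b U by blast
      then show "b \<in> kernel_partition (points k l) f"
        unfolding kernel_partition_def blk[OF b x, symmetric] by (rule imageI)
    next
      assume "b \<in> kernel_partition (points k l) f"
      then obtain x where x: "x \<in> points k l" "b = {y \<in> points k l. f y = f x}"
        unfolding kernel_partition_def by blast
      then obtain b' where "b' \<in> B" "x \<in> b'" using U by blast
      then show "b \<in> B" using x blk by simp
    qed
  qed
  also have "\<dots> = kernel_partition (points k l)
      (row_label (map (\<lambda>i. f (Upper (Suc i))) [0..<k]) (map (\<lambda>i. f (Lower (Suc i))) [0..<l]))"
    by (rule kernel_partition_cong) (auto simp: points_eq_Suc)
  finally show ?thesis using that[of "map (\<lambda>i. f (Upper (Suc i))) [0..<k]"
        "map (\<lambda>i. f (Lower (Suc i))) [0..<l]"]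
    by (simp add: p two_row_def)
qed

section \<open>Contraction of neighbouring letters as composition with a cap\<close>

definition identify :: "'a \<Rightarrow> 'a \<Rightarrow> 'a \<Rightarrow> 'a" where
  "identify a b = id(b := a)"

lemma mem_Union_kernel_partition_iff:
  "(x, y) \<in> (\<Union>b\<in>kernel_partition A f. h ` b \<times> h ` b) \<longleftrightarrow>
    (\<exists>s t. s \<in> A \<and> t \<in> A \<and> x = h s \<and> y = h t \<and> f s = f t)"
proof
  assume "(x, y) \<in> (\<Union>b\<in>kernel_partition A f. h ` b \<times> h ` b)"
  then obtain z s t where "s \<in> A" "t \<in> A" "f s = f z" "f t = f z" "x = h s" "y = h t"
    unfolding kernel_partition_def by auto
  then show "\<exists>s t. s \<in> A \<and> t \<in> A \<and> x = h s \<and> y = h t \<and> f s = f t"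
    by (intro exI[of _ s] exI[of _ t]) simp
next
  assume "\<exists>s t. s \<in> A \<and> t \<in> A \<and> x = h s \<and> y = h t \<and> f s = f t"
  then obtain s t where "s \<in> A" "t \<in> A" "x = h s" "y = h t" "f s = f t" by blast
  then show "(x, y) \<in> (\<Union>b\<in>kernel_partition A f. h ` b \<times> h ` b)"
    unfolding kernel_partition_def by (intro UN_I[of "{y \<in> A. f y = f s}"]) auto
qed

text \<open>Since \<open>c # Z\<close> is distinct, the lower partition is a cap on the first two
  middle points with vertical strings next to it. The cap joins the blocks of \<open>a\<close> and
  \<open>b\<close>; the strings carry the other labels down.\<close>

lemma compose_cap:
  fixes Y :: "'a list" and Z :: "'b list"
  assumes Z: "distinct (c # Z)" "length Z = length Y"
  shows "compose (two_row (c # c # Z) Z) (two_row [] (a # b # Y))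
    = two_row [] (map (identify a b) Y)"
proof -
  define n where "n = length Y"
  let ?p = "two_row [] (a # b # Y)" and ?q = "two_row (c # c # Z) Z"
  define A where "A = (\<lambda>i. Mid (Suc i)) ` {..<Suc (Suc n)} \<union> (\<lambda>i. Bot (Suc i)) ` {..<n}"
  \<comment> \<open>The label of a diagram point after the identification. There are no top points,
    so the value given to them is a dummy.\<close>
  define g where "g x = identify a b (case x of Mid i \<Rightarrow> (a # b # Y) ! (i - 1) | Bot i \<Rightarrow> Y ! (i - 1)
    | Top i \<Rightarrow> a)" for x
  have g_simps [simp]: "g (Mid (Suc i)) = identify a b ((a # b # Y) ! i)"
    "g (Bot (Suc i)) = identify a b (Y ! i)" for i
    by (simp_all add: g_def)
  define r where "r = joined ?p ?q"
  have r_iff: "(x, y) \<in> r \<longleftrightarrow>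
     (\<exists>s t. s \<in> points 0 (n + 2) \<and> t \<in> points 0 (n + 2) \<and> x = in_upper_half s \<and> y = in_upper_half t \<and>
        row_label [] (a # b # Y) s = row_label [] (a # b # Y) t) \<or>
     (\<exists>s t. s \<in> points (n + 2) n \<and> t \<in> points (n + 2) n \<and> x = in_lower_half s \<and> y = in_lower_half t \<and>
        row_label (c # c # Z) Z s = row_label (c # c # Z) Z t)" for x y
    using Z unfolding r_def joined_def Un_iff two_row_sel mem_Union_kernel_partition_iff
    by (simp add: n_def)
  have zc: "Z ! i \<noteq> c" "c \<noteq> Z ! i" if "i < n" for i using Z that nth_mem[of i Z] by (auto simp: n_def)
  have zz: "Z ! i = Z ! j \<longleftrightarrow> i = j" if "i < n" "j < n" for i j using Z that by (simp add: n_def nth_eq_iff_index_eq)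
  have sub: "r \<subseteq> {(x, y). x \<in> A \<and> y \<in> A \<and> g x = g y}"
  proof
    fix z assume "z \<in> r"
    then obtain x y where z: "z = (x, y)" "(x, y) \<in> r" by (cases z) auto
    from z(2) have "x \<in> A \<and> y \<in> A \<and> g x = g y"
      unfolding r_iff
    proof (elim disjE exE conjE)
      fix s t assume "s \<in> points 0 (n + 2)" "t \<in> points 0 (n + 2)" "x = in_upper_half s"
        "y = in_upper_half t" "row_label [] (a # b # Y) s = row_label [] (a # b # Y) t"
      then show ?thesis by (auto simp: A_def points_eq_Suc)
    next
      fix s t assume "s \<in> points (n + 2) n" "t \<in> points (n + 2) n" "x = in_lower_half s"
        "y = in_lower_half t" "row_label (c # c # Z) Z s = row_label (c # c # Z) Z t"
      then show ?thesis
        by (auto simp: A_def points_eq_Suc nth_Cons less_Suc_eq_0_disj zc zz identify_def split: nat.splits)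
    qed
    then show "z \<in> {(x, y). x \<in> A \<and> y \<in> A \<and> g x = g y}" using z by simp
  qed
  have low: "(in_lower_half s, in_lower_half t) \<in> r"
    if "s \<in> points (n + 2) n" "t \<in> points (n + 2) n"
      "row_label (c # c # Z) Z s = row_label (c # c # Z) Z t" for s t
    unfolding r_iff using that by blast
  have bot: "(Mid (Suc (Suc (Suc i))), Bot (Suc i)) \<in> r" "(Bot (Suc i), Mid (Suc (Suc (Suc i)))) \<in> r"
    if "i < n" for i
    using that low[of "Lower (Suc i)" "Upper (Suc (Suc (Suc i)))"]
      low[of "Upper (Suc (Suc (Suc i)))" "Lower (Suc i)"] by (simp_all add: points_def)
  have cap: "(Mid 1, Mid 2) \<in> r" "(Mid 2, Mid 1) \<in> r"
    using low[of "Upper 1" "Upper 2"] low[of "Upper 2" "Upper 1"]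
    by (simp_all add: points_def numeral_2_eq_2)
  have mid: "(Mid (Suc i), Mid (Suc j)) \<in> r"
    if "i < n + 2" "j < n + 2" "(a # b # Y) ! i = (a # b # Y) ! j" for i j
    unfolding r_iff using that
    by (intro disjI1 exI[of _ "Lower (Suc i)"] exI[of _ "Lower (Suc j)"]) (simp add: points_def)
  have conn_mid: "(Mid (Suc i), Mid (Suc j)) \<in> r\<^sup>+"
    if ij: "i < n + 2" "j < n + 2" and eq: "g (Mid (Suc i)) = g (Mid (Suc j))" for i j
  proof -
    let ?l = "\<lambda>i. (a # b # Y) ! i"
    consider "?l i = ?l j" | "?l i = a" "?l j = b" | "?l i = b" "?l j = a"
      using eq by (auto simp: identify_def split: if_splits)
    then show ?thesis
    proof cases
      case 1 then show ?thesis using mid ij by blast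
    next
      case 2
      then have r: "(Mid (Suc i), Mid 1) \<in> r" "(Mid 2, Mid (Suc j)) \<in> r"
        using mid[of i 0] mid[of 1 j] ij by (simp_all add: numeral_2_eq_2)
      show ?thesis by (rule trancl_into_trancl2[OF r(1) trancl_into_trancl2[OF cap(1) r_into_trancl[OF r(2)]]])
    next
      case 3
      then have r: "(Mid (Suc i), Mid 2) \<in> r" "(Mid 1, Mid (Suc j)) \<in> r"
        using mid[of i 1] mid[of 0 j] ij by (simp_all add: numeral_2_eq_2)
      show ?thesis by (rule trancl_into_trancl2[OF r(1) trancl_into_trancl2[OF cap(2) r_into_trancl[OF r(2)]]])
    qed
  qed
  have rep: "\<exists>i<n + 2. (x, Mid (Suc i)) \<in> r \<and> (Mid (Suc i), x) \<in> r \<and> g x = g (Mid (Suc i))" if "x \<in> A" for x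
    using that unfolding A_def
  proof
    assume "x \<in> (\<lambda>i. Mid (Suc i)) ` {..<Suc (Suc n)}"
    then show ?thesis using mid by auto
  next
    assume "x \<in> (\<lambda>i. Bot (Suc i)) ` {..<n}"
    then obtain i where "i < n" "x = Bot (Suc i)" by auto
    then show ?thesis using bot[of i] by (intro exI[of _ "Suc (Suc i)"]) simp
  qed
  have conn: "(x, y) \<in> r\<^sup>+" if "x \<in> A" "y \<in> A" "g x = g y" for x y
  proof -
    obtain i where i: "i < n + 2" "(x, Mid (Suc i)) \<in> r" "g x = g (Mid (Suc i))"
      using rep[OF \<open>x \<in> A\<close>] by blast
    obtain j where j: "j < n + 2" "(Mid (Suc j), y) \<in> r" "g y = g (Mid (Suc j))"
      using rep[OF \<open>y \<in> A\<close>] by blast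
    have "g (Mid (Suc i)) = g (Mid (Suc j))" using i(3) j(3) that(3) by (simp only:)
    then have "(Mid (Suc i), Mid (Suc j)) \<in> r\<^sup>+" by (rule conn_mid[OF i(1) j(1)])
    then show ?thesis by (rule trancl_into_trancl[OF trancl_into_trancl2[OF i(2)] j(2)])
  qed
  have "(-`) outer_point ` (Field r // r\<^sup>+) - {{}} = kernel_partition (outer_point -` A) (g \<circ> outer_point)"
    by (simp only: quotient_trancl_eq_kernel_partition[OF sub conn] kernel_partition_vimage)
  also have "\<dots> = kernel_partition (points 0 n) (row_label [] (map (identify a b) Y))"
  proof (rule kernel_partition_cong)
    have "x \<in> outer_point -` A \<longleftrightarrow> x \<in> points 0 n" for x
      by (cases x) (auto simp: A_def points_eq_Suc)
    then show A: "outer_point -` A = points 0 n" by blast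
    show "(g \<circ> outer_point) x = (g \<circ> outer_point) y \<longleftrightarrow>
      row_label [] (map (identify a b) Y) x = row_label [] (map (identify a b) Y) y"
      if "x \<in> outer_point -` A" "y \<in> outer_point -` A" for x y
      using that unfolding A by (auto simp: points_eq_Suc n_def)
  qed
  finally show ?thesis unfolding compose_def r_def[symmetric] using Z
    by (simp add: two_row_def n_def)
qed

lemma identify_same [simp]: "identify a a = id"
  by (simp add: identify_def fun_eq_iff)


subsection \<open>Closure properties of categories\<close>

locale category =
  fixes C :: "partition set"
  assumes partition_category: "partition_category C"
begin

lemma sub_all_partitions: "C \<subseteq> all_partitions"
  and id_partition_in: "id_partition \<in> C"
  and tensor_in: "p \<in> C \<Longrightarrow> q \<in> C \<Longrightarrow> tensor p q \<in> C"
  and compose_in: "p \<in> C \<Longrightarrow> q \<in> C \<Longrightarrow> lowers p = uppers q \<Longrightarrow> compose q p \<in> C"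
  and involution_in: "p \<in> C \<Longrightarrow> involution p \<in> C"
  and rotate_left_down_in: "p \<in> C \<Longrightarrow> 0 < uppers p \<Longrightarrow> rotate_left_down p \<in> C"
  and rotate_right_down_in: "p \<in> C \<Longrightarrow> 0 < uppers p \<Longrightarrow> rotate_right_down p \<in> C"
  and rotate_left_up_in: "p \<in> C \<Longrightarrow> 0 < lowers p \<Longrightarrow> rotate_left_up p \<in> C"
  using partition_category by (auto simp: partition_category_def)

definition contains :: "nat list \<Rightarrow> bool" where
  "contains w \<longleftrightarrow> word_partition w \<in> C"

lemma contains_map:
  assumes "contains w" "inj_on f (set w)"
  shows "contains (map f w)"
  using assms by (simp add: contains_def word_partition_map)

text \<open>Rotating the upper points down on the left, one by one, reverses the upper row.\<close>

lemma two_row_in_iff: "two_row u v \<in> C \<longleftrightarrow> contains (rev u @ v)"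
proof (induction u arbitrary: v)
  case Nil
  then show ?case by (simp add: contains_def word_partition_eq_two_row)
next
  case (Cons a u)
  have "two_row (a # u) v \<in> C \<longleftrightarrow> two_row u (a # v) \<in> C"
    using rotate_left_down_in[of "two_row (a # u) v"] rotate_left_up_in[of "two_row u (a # v)"]
    by (auto simp: rotate_left_down_two_row rotate_left_up_two_row)
  with Cons.IH show ?case by simp
qed

lemma contains_rotate1: "contains (a # w) \<Longrightarrow> contains (w @ [a])"
  using rotate_right_down_in[of "two_row [a] w"] rotate_right_down_two_row[of "[]" a w]
  by (simp add: two_row_in_iff)

lemma contains_rotate: "contains (u @ v) \<Longrightarrow> contains (v @ u)"
proof (induction u arbitrary: v)
  case (Cons a u)
  from Cons.prems have "contains (u @ v @ [a])" using contains_rotate1[of a "u @ v"] by simp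
  from Cons.IH[OF this] show ?case by simp
qed simp

lemma contains_rev: "contains w \<Longrightarrow> contains (rev w)"
  using involution_in[of "two_row [] w"] by (simp add: involution_two_row two_row_in_iff)

lemma contains_append:
  assumes "contains u" "contains v" "set u \<inter> set v = {}"
  shows "contains (u @ v)"
  using assms tensor_in[of "two_row [] u" "two_row [] v"]
  by (simp add: contains_def word_partition_eq_two_row tensor_word_partition)

lemma contains_insert:
  assumes "contains (u @ v)" "contains w" "set w \<inter> set (u @ v) = {}"
  shows "contains (u @ w @ v)"
proof -
  have "contains (v @ u)" using assms(1) by (rule contains_rotate)
  then have "contains ((v @ u) @ w)" using contains_append[of "v @ u" w] assms by auto
  then show ?thesis using contains_rotate[of v "u @ w"] by simp
qed

lemma contains_pair: "contains [a, a]"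
proof -
  have "id_partition = two_row [a] [a]"
    unfolding id_partition_def two_row_def kernel_partition_def by (auto simp: points_eq_Suc)
  then show ?thesis using id_partition_in two_row_in_iff[of "[a]" "[a]"] by simp
qed

text \<open>The two letters are rotated to the front, where \<open>compose_cap\<close> applies; its
  capping partition lies in the category because its word consists of nested pairs.\<close>

lemma contains_contract:
  assumes "contains (u @ a # b # v)"
  shows "contains (map (identify a b) (u @ v))"
proof -
  have mirror: "contains (rev zs @ zs)" if "distinct zs" "zs \<noteq> []" for zs
    using that(2,1)
  proof (induction zs rule: list_nonempty_induct)
    case (cons z zs)
    then show ?case using contains_insert[of "rev zs" zs "[z, z]"] contains_pair by auto
  qed (simp add: contains_pair)
  have "contains (a # b # v @ u)" using contains_rotate[OF assms] by simp
  then have p: "two_row [] (a # b # v @ u) \<in> C" by (simp add: two_row_in_iff)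
  define Z where "Z = [0..<length (v @ u)]"
  define c where "c = length (v @ u)"
  have Z: "distinct (c # Z)" "length Z = length (v @ u)" by (simp_all add: Z_def c_def)
  have q: "two_row (c # c # Z) Z \<in> C" using mirror[of "c # Z"] Z(1) by (simp add: two_row_in_iff)
  have "compose (two_row (c # c # Z) Z) (two_row [] (a # b # v @ u)) \<in> C"
    using p q Z(2) by (intro compose_in) simp_all
  then have "two_row [] (map (identify a b) (v @ u)) \<in> C" by (simp only: compose_cap[OF Z])
  then have "contains (map (identify a b) v @ map (identify a b) u)" by (simp add: two_row_in_iff)
  from contains_rotate[OF this] show ?thesis by simp
qed


lemma contains_cancel: "contains (u @ a # a # v) \<Longrightarrow> contains (u @ v)"
  using contains_contract[of u a a v] by simp

end


subsection \<open>Free reduction\<close>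

text \<open>Left multiplication by the generator \<open>a\<close> on reduced words of a free product
  of groups of order two, one for each letter. Thus \<open>red\<close> is the normal form, and
  \<open>foldr push u s\<close> is the product of \<open>u\<close> with a reduced word
  \<open>s\<close>.\<close>

fun push :: "'a \<Rightarrow> 'a list \<Rightarrow> 'a list" where
  "push a [] = [a]"
| "push a (b # s) = (if a = b then s else a # b # s)"

definition red :: "'a list \<Rightarrow> 'a list" where
  "red w = foldr push w []"

lemma distinct_adj_push: "distinct_adj s \<Longrightarrow> distinct_adj (push a s)"
  by (cases s) (auto dest: distinct_adj_ConsD)

lemma push_push: "distinct_adj s \<Longrightarrow> push a (push a s) = s"
  by (cases s; cases "tl s") auto

lemma distinct_adj_foldr_push: "distinct_adj s \<Longrightarrow> distinct_adj (foldr push w s)"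
  by (induction w) (auto intro: distinct_adj_push)

lemma distinct_adj_red: "distinct_adj (red w)"
  by (simp add: red_def distinct_adj_foldr_push)

lemma red_Nil [simp]: "red [] = []"
  and red_Cons: "red (a # w) = push a (red w)"
  and red_append: "red (u @ v) = foldr push u (red v)"
  by (simp_all add: red_def)

lemma red_eq_self: "distinct_adj w \<Longrightarrow> red w = w"
proof (induction w)
  case (Cons a w)
  then show ?case by (cases w) (auto simp: red_Cons)
qed simp

lemma red_cancel: "red (u @ a # a # v) = red (u @ v)"
  by (simp add: red_append red_Cons push_push distinct_adj_red)

lemma foldr_push_push:
  "distinct_adj s \<Longrightarrow> foldr push (push a r) s = push a (foldr push r s)"
  by (cases r) (auto simp: push_push distinct_adj_foldr_push)

lemma foldr_push_red: "distinct_adj s \<Longrightarrow> foldr push (red w) s = foldr push w s"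
  by (induction w) (simp_all add: red_Cons foldr_push_push)

lemma foldr_push_rev: "distinct_adj s \<Longrightarrow> foldr push (rev w) (foldr push w s) = s"
  by (induction w arbitrary: s) (simp_all add: push_push distinct_adj_foldr_push)

text \<open>Each letter is its own inverse, so \<open>rev u\<close> represents the inverse of
  \<open>u\<close>.\<close>

lemma red_append_Nil_right:
  assumes "red (u @ v) = []"
  shows "red v = red (rev u)"
  using assms foldr_push_rev[of "red v" u] by (simp add: red_append distinct_adj_red) (simp add: red_def)

text \<open>As \<open>push\<close> multiplies on the left only, \<open>u @ v\<close> is applied to
  the inverse of \<open>v\<close>.\<close>

lemma red_append_Nil_left:
  assumes "red (u @ v) = []"
  shows "red u = red (rev v)"
proof -
  have "foldr push v (red (rev v)) = []"
    using foldr_push_rev[of "[]" "rev v"] by (simp add: red_def)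
  then have "red u = foldr push (u @ v) (red (rev v))" by (simp add: red_def)
  also have "\<dots> = foldr push (red (u @ v)) (red (rev v))"
    by (rule foldr_push_red[symmetric]) (rule distinct_adj_red)
  finally show ?thesis using assms by simp
qed

lemma set_red: "set (red w) \<subseteq> set w"
proof (induction w)
  case (Cons a w)
  then show ?case by (cases "red w") (auto simp: red_Cons)
qed simp

lemma red_map:
  assumes "inj_on f (set w)"
  shows "red (map f w) = map f (red w)"
  using assms
proof (induction w)
  case (Cons a w)
  have "push (f a) (map f s) = map f (push a s)" if "set s \<subseteq> set w" for s
    using that Cons.prems by (cases s) (auto simp: inj_on_def)
  with Cons show ?case using set_red[of w] by (simp add: red_Cons)
qed simp

text \<open>Each cancellation removes two copies of one letter. Hence every letter occurs an even
  number of times in a word that reduces to the empty word.\<close>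

lemma even_count_list_red: "even (count_list (red w) x) \<longleftrightarrow> even (count_list w x)"
proof (induction w)
  case (Cons a w)
  then show ?case by (cases "red w") (auto simp: red_Cons split: if_splits)
qed simp

lemma first_repetition:
  assumes "\<not> distinct_adj w"
  obtains u a v where "w = u @ a # a # v" "distinct_adj (u @ [a])"
  using assms
proof (induction w arbitrary: thesis)
  case (Cons b w)
  show ?case
  proof (cases "distinct_adj w")
    case True
    with Cons.prems(2) obtain v where "w = b # v" by (cases w) auto
    then show ?thesis using Cons.prems(1)[of "[]" b v] by simp
  next
    case False
    then obtain u a v where w: "w = u @ a # a # v" "distinct_adj (u @ [a])" using Cons.IH by blast
    show ?thesis
    proof (cases "distinct_adj (b # u @ [a])")
      case True
      then show ?thesis using Cons.prems(1)[of "b # u" a v] w by simp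
    next
      case False
      then have "\<exists>v'. w = b # v'" using w by (cases u) auto
      then show ?thesis using Cons.prems(1)[of "[]" b] by auto
    qed
  qed
qed simp

lemma consecutive_occurrences:
  assumes "\<not> distinct w"
  obtains x y z t where "w = x @ y # z @ y # t" "y \<notin> set z"
proof -
  obtain x y z t where w: "w = x @ [y] @ z @ [y] @ t"
    using not_distinct_decomp[OF assms] by blast
  have "y \<in> set (z @ [y])" by simp
  then obtain z' t' where z: "z @ [y] = z' @ y # t'" "y \<notin> set z'"
    by (blast dest: split_list_first)
  have "w = x @ y # (z @ [y]) @ t" using w by simp
  also have "\<dots> = x @ y # z' @ y # t' @ t" unfolding z(1) by simp
  finally show ?thesis using that z(2) by blast
qed

section \<open>Gluing of words along a common part\<close>

context category
begin

lemma contains_red: "contains (u @ w @ v) \<Longrightarrow> contains (u @ red w @ v)"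
proof (induction w arbitrary: u)
  case (Cons a w)
  have "contains (u @ a # red w @ v)" using Cons.IH[of "u @ [a]"] Cons.prems by simp
  then show ?case using contains_cancel[of u a "tl (red w) @ v"] by (cases "red w") (auto simp: red_Cons)
qed simp

text \<open>A copy of \<open>rev Q @ R\<close> in fresh letters is appended, and \<open>Q\<close> is
  contracted against its mirror image from the middle outwards. This identifies the letters of
  \<open>Q\<close> with their copies; as \<open>P\<close> and \<open>R\<close> share no others,
  renaming back gives \<open>P @ R\<close>.\<close>

lemma contains_glue:
  assumes PQ: "contains (P @ Q)" and QR: "contains (rev Q @ R)" and PR: "set P \<inter> set R \<subseteq> set Q"
  shows "contains (P @ R)"
proof -
  define N where "N = Suc (Max (set (P @ Q @ R @ [0])))"
  have N: "x < N" if "x \<in> set P \<or> x \<in> set Q \<or> x \<in> set R" for x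
    unfolding N_def less_Suc_eq_le using that by (intro Max_ge) auto
  define h where "h D x = (if x \<in> D then x else x + N)" for D x
  \<comment> \<open>The letters of \<^term>\<open>D\<close> have already been identified with their fresh copies.\<close>
  have step: "contains (P @ map (h (D \<union> set Q)) R)"
    if "contains (P @ Q @ rev (map (h D) Q) @ map (h D) R)" "\<And>x. x \<in> set Q \<Longrightarrow> x < N" for D Q
    using that
  proof (induction Q arbitrary: D rule: rev_induct)
    case (snoc q Q)
    let ?f = "identify q (h D q)"
    have q: "q < N" using snoc.prems by simp
    have small: "?f x = x" if "x < N" for x
      using that by (auto simp: identify_def h_def)
    have h: "?f (h D x) = h (insert q D) x" if "x < N" for x
      using that q by (auto simp: identify_def h_def)
    have "contains ((P @ Q) @ q # h D q # rev (map (h D) Q) @ map (h D) R)"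
      using snoc.prems by simp
    from contains_contract[OF this]
    have "contains (map ?f P @ map ?f Q @ rev (map (?f \<circ> h D) Q) @ map (?f \<circ> h D) R)"
      by (simp add: rev_map)
    moreover have "map ?f P = P" "map ?f Q = Q"
      "map (?f \<circ> h D) Q = map (h (insert q D)) Q" "map (?f \<circ> h D) R = map (h (insert q D)) R"
      using N snoc.prems(2) by (simp_all add: small h map_idI)
    ultimately have "contains (P @ Q @ rev (map (h (insert q D)) Q) @ map (h (insert q D)) R)"
      by (simp only:)
    from snoc.IH[OF this] snoc.prems(2) show ?case by simp
  qed simp
  have "contains (map (h {}) (rev Q @ R))"
    using QR by (rule contains_map) (auto simp: h_def inj_on_def)
  moreover have "set (P @ Q) \<inter> set (map (h {}) (rev Q @ R)) = {}"
  proof -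
    have "y \<notin> set (P @ Q)" if "y \<in> set (map (h {}) (rev Q @ R))" for y
      using that N[of y] by (auto simp: h_def)
    then show ?thesis by blast
  qed
  ultimately have "contains ((P @ Q) @ map (h {}) (rev Q @ R))" by (rule contains_append[OF PQ])
  then have "contains (P @ Q @ rev (map (h {}) Q) @ map (h {}) R)" by (simp add: rev_map)
  from step[OF this] N have glued: "contains (P @ map (h (set Q)) R)" by simp
  \<comment> \<open>Undoes the shift by \<open>N\<close>. It is injective on the glued word because
    a letter of \<open>R\<close> that is still shifted lies outside \<open>Q\<close> and so does not
    occur in \<open>P\<close>.\<close>
  define k where "k y = (if y < N then y else y - N)" for y
  have kP: "k x = x" if "x \<in> set P" for x using N that by (simp add: k_def)
  have kR: "k (h D x) = x" if "x \<in> set R" for D x using N that by (auto simp: k_def h_def)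
  have "inj_on k (set (P @ map (h (set Q)) R))"
  proof (rule inj_on_inverseI[where g = "\<lambda>x. if x \<in> set P then x else h (set Q) x"])
    fix z assume "z \<in> set (P @ map (h (set Q)) R)"
    then consider "z \<in> set P" | x where "x \<in> set R" "z = h (set Q) x" by auto
    then show "(if k z \<in> set P then k z else h (set Q) (k z)) = z"
    proof cases
      case 1
      then show ?thesis by (simp add: kP)
    next
      case 2
      then show ?thesis using PR by (auto simp: kR) (auto simp: h_def)
    qed
  qed
  from contains_map[OF glued this] have "contains (map k P @ map (\<lambda>x. k (h (set Q) x)) R)"
    by (simp add: o_def)
  moreover have "map k P = P" by (rule map_idI) (rule kP)
  moreover have "map (\<lambda>x. k (h (set Q) x)) R = R" by (rule map_idI) (rule kR)
  ultimately show ?thesis by simp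
qed

end

section \<open>Consequences of the four block partition\<close>

locale four_block_category = category +
  assumes four_block_in: "four_block \<in> C"
begin

lemma contains_four: "contains [a, a, a, a]"
proof -
  have "contains [0, 0, 0, 0]" using four_block_in by (simp add: four_block_def contains_def)
  from contains_map[OF this, of "\<lambda>_. a"] show ?thesis by simp
qed

text \<open>Gluing with \<open>[a, a, a, a]\<close> along a single \<open>a\<close> replaces this
  letter by the other three.\<close>

lemma contains_triple:
  assumes "contains (u @ a # v)"
  shows "contains (u @ a # a # a # v)"
proof -
  have "contains (a # v @ u)" using contains_rotate[OF assms] by simp
  then have "contains ([a, a, a] @ (v @ u))"
    using contains_glue[of "[a, a, a]" "[a]" "v @ u"] contains_four[of a] by simp
  then show ?thesis using contains_rotate[of "[a, a, a] @ v" u] by simp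
qed

text \<open>After tripling \<open>a\<close>, its last copy is contracted with \<open>b\<close>; the
  two copies left stand in the places of \<open>a\<close> and \<open>b\<close>.\<close>

lemma contains_merge:
  assumes "contains (u @ a # b # v)"
  shows "contains (map (identify a b) (u @ a # b # v))"
  using contains_contract[of "u @ [a, a]" a b v] contains_triple[OF assms]
  by (cases "a = b") (simp_all add: identify_def)

lemma contains_merge':
  assumes "contains (u @ b # a # v)"
  shows "contains (map (identify a b) (u @ b # a # v))"
  using contains_rev[OF contains_merge[of "rev v" a b "rev u"]] contains_rev[OF assms]
  by (simp add: rev_map)

end


subsection \<open>Words of hyperoctahedral categories are closed walks on trees\<close>

locale hyperoctahedral_category = four_block_category +
  assumes double_singleton_notin: "double_singleton \<notin> C"
    and pair_positioner_notin: "pair_positioner \<notin> C"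
begin

lemma not_contains_two_letters:
  assumes "a \<noteq> b"
  shows "\<not> contains [a, b]"
proof
  assume "contains [a, b]"
  from contains_map[OF this, of "\<lambda>x. if x = a then 0 else 1"] assms
  show False using double_singleton_notin by (auto simp: double_singleton_def contains_def inj_on_def)
qed

lemma not_contains_pair_positioner:
  assumes "a \<noteq> b"
  shows "\<not> contains [a, a, b, a, a, b]"
proof
  assume "contains [a, a, b, a, a, b]"
  then have "contains [b, a, a, b, a, a]" using contains_rotate[of "[a, a]" "[b, a, a, b]"] by simp
  then have "two_row [a, a, b] [b, a, a] \<in> C" by (simp add: two_row_in_iff)
  moreover have "two_row [a, a, b] [b, a, a] = pair_positioner"
  proof -
    have P: "points 3 3 = {Upper 1, Upper 2, Upper 3, Lower 1, Lower 2, Lower 3}"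
      by (auto simp: points_def)
    let ?f = "row_label [a, a, b] [b, a, a]"
    have "{y \<in> points 3 3. ?f y = a} = {Upper 1, Upper 2, Lower 2, Lower 3}"
      "{y \<in> points 3 3. ?f y = b} = {Upper 3, Lower 1}"
      unfolding P using assms by (auto simp: numeral_eq_Suc)
    moreover have "?f ` points 3 3 = {a, b}" unfolding P by (auto simp: numeral_eq_Suc)
    moreover have "kernel_partition (points 3 3) ?f = (\<lambda>c. {y \<in> points 3 3. ?f y = c}) ` ?f ` points 3 3"
      by (simp add: kernel_partition_def image_image)
    ultimately have "kernel_partition (points 3 3) ?f
      = {{Upper 1, Upper 2, Lower 2, Lower 3}, {Upper 3, Lower 1}}" by simp
    then show ?thesis by (simp add: two_row_def pair_positioner_def eval_nat_numeral)
  qed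
  ultimately show False using pair_positioner_notin by simp
qed

text \<open>Contracting the two letters behind \<open>b\<close> leaves \<open>b\<close> alone and
  shortens the word, down to \<open>[b]\<close> or \<open>[b, x]\<close>. The latter is a double
  singleton; the former yields one by appending a renamed copy.\<close>

lemma not_contains_singleton_letter:
  assumes "contains (b # w)" "b \<notin> set w"
  shows False
  using assms
proof (induction w rule: length_induct)
  case (1 w)
  consider "w = []" | x where "w = [x]" | x y v where "w = x # y # v"
    by (cases w; cases "tl w") auto
  then show ?case
  proof cases
    case 1
    then have "contains [b]" using "1.prems"(1) by simp
    moreover from contains_map[OF this, of Suc] have "contains [Suc b]" by simp
    ultimately have "contains ([b] @ [Suc b])" by (rule contains_append) simp
    then show False using not_contains_two_letters[of b "Suc b"] by simp
  next
    case (2 x)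
    then show False using "1.prems" not_contains_two_letters[of b x] by auto
  next
    case (3 x y v)
    have "contains (map (identify x y) ([b] @ v))"
      using contains_contract[of "[b]" x y v] "1.prems" 3 by simp
    then have "contains (b # map (identify x y) v)"
      using "1.prems"(2) 3 by (simp add: identify_def)
    moreover have "b \<notin> set (map (identify x y) v)" using "1.prems"(2) 3 by (auto simp: identify_def)
    ultimately show False using "1.IH"[rule_format, of "map (identify x y) v"] 3 by simp
  qed
qed

text \<open>If \<open>b\<close> does not return, it is a singleton letter. Otherwise the first and,
  separately, the last \<open>a\<close> of \<open>[a, b, a]\<close> is tripled. Gluing one result
  with the mirror image of the other along the rest and cancelling leaves a rotation of the pair
  positioner.\<close>

lemma not_contains_alternating:
  assumes "contains (a # b # a # v)" "a \<noteq> b"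
  shows False
proof (cases "b \<in> set v")
  case False
  have "contains (b # (a # v) @ [a])" using contains_rotate[of "[a]" "b # a # v"] assms by simp
  then show False using not_contains_singleton_letter False assms(2) by fastforce
next
  case True
  \<comment> \<open>Two extra copies of \<open>a\<close> are moved behind \<open>v\<close>, so that
    the part glued along contains \<open>a\<close> as well as \<open>b\<close>.\<close>
  have "contains (a # a # a # b # a # v)" using contains_triple[of "[]" a "b # a # v"] assms by simp
  then have aba: "contains ([a, b, a] @ (v @ [a, a]))"
    using contains_rotate[of "[a, a]" "a # b # a # v"] by simp
  have 1: "contains ([a, a, a, b, a] @ (v @ [a, a]))"
    using contains_triple[of "[]"] aba by simp
  have "contains ([a, b, a, a, a] @ (v @ [a, a]))"
    using contains_triple[of "[a, b]"] aba by simp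
  then have "contains (rev (v @ [a, a]) @ [a, a, a, b, a])"
    using contains_rev[of "[a, b, a, a, a] @ (v @ [a, a])"] by simp
  with 1 have "contains ([a, a, a, b, a] @ [a, a, a, b, a])"
    using True contains_glue[of "[a, a, a, b, a]" "v @ [a, a]" "[a, a, a, b, a]"] by simp
  then have "contains [a, b, a, a, a, a, b, a]"
    using contains_cancel[of "[]" a "[a, b, a, a, a, a, b, a]"] by simp
  then have "contains [a, b, a, a, b, a]"
    using contains_cancel[of "[a, b]" a "[a, a, b, a]"] by simp
  then have "contains [a, a, b, a, a, b]"
    using contains_rotate[of "[a, b, a, a, b]" "[a]"] by simp
  then show False using not_contains_pair_positioner[OF assms(2)] by simp
qed

text \<open>Turns in \<open>w\<close> can be cancelled. In a reduced \<open>w\<close> a repeated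
  letter would enclose a nonempty reduced word, against the induction hypothesis. If all letters
  differ, the last one is merged with the \<open>a\<close> behind it: a nonempty prefix, now
  enclosed by \<open>a\<close>, contradicts the induction hypothesis, and an empty one contradicts
  \<open>not_contains_alternating\<close>.\<close>

lemma red_between_equal_letters:
  assumes "contains (a # w @ a # v)" "a \<notin> set w"
  shows "red w = []"
  using assms
proof (induction w arbitrary: a v rule: length_induct)
  case (1 w)
  show ?case
  proof (cases "distinct_adj w")
    case False
    then obtain u x z where w: "w = u @ x # x # z" by (rule first_repetition)
    then have "contains (a # (u @ z) @ a # v)"
      using contains_cancel[of "a # u" x "z @ a # v"] "1.prems" by simp
    then have "red (u @ z) = []" using "1.IH"[rule_format, of "u @ z" a v] "1.prems"(2) w by simp
    then show ?thesis by (simp add: w red_cancel)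
  next
    case True
    note adj = this
    show ?thesis
    proof (cases "distinct w")
      case False
      then obtain x' y z' t' where w: "w = x' @ y # z' @ y # t'" "y \<notin> set z'"
        by (rule consecutive_occurrences)
      then have "contains (y # z' @ y # t' @ a # v @ a # x')"
        using contains_rotate[of "a # x'" "y # z' @ y # t' @ a # v"] "1.prems" by simp
      then have "red z' = []"
        using "1.IH"[rule_format, of z' y "t' @ a # v @ a # x'"] w by simp
      moreover have "distinct_adj z'" "z' \<noteq> []" using adj w(1)
        by (auto simp: distinct_adj_append_iff distinct_adj_Cons)
      ultimately show ?thesis by (simp add: red_eq_self)
    next
      case True
      show ?thesis
      proof (cases w rule: rev_cases)
        case (snoc u c)
        show ?thesis
        proof (cases "u = []")
          case True
          then show ?thesis using not_contains_alternating[of a c v] "1.prems" snoc by auto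
        next
          case False
          have "contains (map (identify a c) ((a # u) @ c # a # v))"
            using contains_merge'[of "a # u" c a v] "1.prems"(1) snoc by simp
          moreover have "map (identify a c) u = u"
            using \<open>distinct w\<close> snoc by (auto simp: identify_def intro: map_idI)
          ultimately have "contains (a # u @ a # a # map (identify a c) v)"
            by (simp add: identify_def split: if_splits)
          then have "red u = []"
            using "1.IH"[rule_format, of u a "a # map (identify a c) v"] "1.prems"(2) snoc by simp
          moreover have "distinct_adj u" using adj snoc by (simp add: distinct_adj_append_iff)
          ultimately show ?thesis using False by (simp add: red_eq_self)
        qed
      qed simp
    qed
  qed
qed

text \<open>A walk on a tree without turns repeats no edge: consecutive occurrences of a letter
  would enclose a nonempty reduced word that reduces to the empty one.\<close>

lemma distinct_if_distinct_adj:
  assumes "contains (u @ w @ v)" "distinct_adj w"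
  shows "distinct w"
proof (rule ccontr)
  assume "\<not> distinct w"
  then obtain x y z t where w: "w = x @ y # z @ y # t" "y \<notin> set z"
    by (rule consecutive_occurrences)
  then have "contains (y # z @ y # t @ v @ u @ x)"
    using contains_rotate[of "u @ x" "y # z @ y # t @ v"] assms(1) by simp
  then have "red z = []" using red_between_equal_letters w(2) by blast
  moreover have "distinct_adj z" "z \<noteq> []" using assms(2) w(1)
    by (auto simp: distinct_adj_append_iff distinct_adj_Cons)
  ultimately show False by (simp add: red_eq_self)
qed

text \<open>The reduced form is again a word of \<open>C\<close> and has distinct letters, so its
  first letter would be a singleton letter.\<close>

lemma red_eq_Nil:
  assumes "contains w"
  shows "red w = []"
proof (rule ccontr)
  assume ne: "red w \<noteq> []"
  have c: "contains (red w)" using contains_red[of "[]" w "[]"] assms by simp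
  then have "distinct (red w)"
    using distinct_if_distinct_adj[of "[]" "red w" "[]"] distinct_adj_red[of w] by simp
  then show False using ne c not_contains_singleton_letter by (cases "red w") auto
qed

end


subsection \<open>Comparison of two categories\<close>

lemma (in category) contains_pi_iff:
  assumes "distinct u"
  shows "contains (u @ rev u @ u @ rev u) \<longleftrightarrow> pi_partition (length u) \<in> C"
proof -
  let ?w = "[1..<length u + 1]"
  let ?f = "\<lambda>i. u ! (i - 1)"
  have u: "map ?f ?w = u" by (rule nth_equalityI) (simp_all add: nth_append del: upt_Suc)
  have "inj_on ?f (set ?w)"
    using assms by (auto simp: inj_on_def nth_eq_iff_index_eq)
  then have "word_partition (map ?f (?w @ rev ?w @ ?w @ rev ?w)) = pi_partition (length u)"
    unfolding pi_partition_def Let_def by (intro word_partition_map) simp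
  then show ?thesis unfolding contains_def map_append rev_map[symmetric] u by simp
qed

text \<open>Cancelling the innermost letter at its two turns leads from
  \<open>pi_partition (Suc n)\<close> to \<open>pi_partition n\<close>.\<close>

lemma (in category) pi_partition_antimono:
  assumes "pi_partition k \<in> C" "j \<le> k"
  shows "pi_partition j \<in> C"
  using assms(2,1)
proof (induction rule: inc_induct)
  case (step n)
  let ?u = "[0..<n]"
  have "contains ((?u @ [n]) @ rev (?u @ [n]) @ (?u @ [n]) @ rev (?u @ [n]))"
    using step contains_pi_iff[of "?u @ [n]"] by simp
  then have "contains (?u @ rev ?u @ ?u @ rev ?u)"
    using contains_cancel[of "?u" n "rev ?u @ ?u @ n # n # rev ?u"]
      contains_cancel[of "?u @ rev ?u @ ?u" n "rev ?u"] by simp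
  then show ?case using contains_pi_iff[of ?u] by simp
qed simp

locale pi_comparison = hyperoctahedral_category C + D: four_block_category D for C D +
  assumes pi_transfer: "1 \<le> j \<Longrightarrow> pi_partition j \<in> C \<Longrightarrow> pi_partition j \<in> D"
begin

text \<open>Freely reducing \<^term>\<open>x\<close> and \<^term>\<open>rev y\<close> shows that the \<open>\<pi>\<close> partition of the path \<open>cgd\<close> is in \<^term>\<open>C\<close>; gluing with
  it along \<open>dg\<^sup>-\<^sup>1ccg\<close> restores the deleted turn.\<close>

lemma restore_mirrored_turn:
  assumes w: "contains (c # c # g @ d # d # x @ c # c # rev y @ d # d # rev g)"
    and short: "D.contains (c # c # g @ d # d # x @ c # c # rev y @ rev g)"
    and redx: "red (g @ x) = []" and redy: "red (g @ y) = []"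
    and adj: "distinct_adj g" and cd: "c \<noteq> d" "c \<notin> set g" "d \<notin> set g"
  shows "D.contains (c # c # g @ d # d # x @ c # c # rev y @ d # d # rev g)"
proof -
  let ?u = "c # g @ [d]"
  have "distinct g" using distinct_if_distinct_adj[of "[c, c]" g] w adj by simp
  then have du: "distinct ?u" using cd by simp
  have "red x = rev g" using red_append_Nil_right[OF redx] adj by (simp add: red_eq_self)
  moreover have "red (rev y) = g" using red_append_Nil_left[OF redy] adj by (simp add: red_eq_self)
  ultimately have "contains (c # c # g @ d # d # rev g @ c # c # g @ d # d # rev g)"
    using contains_red[of "c # c # g @ [d, d]" x "c # c # rev y @ d # d # rev g"]
      contains_red[of "c # c # g @ d # d # rev g @ [c, c]" "rev y" "d # d # rev g"] w by simp
  then have "contains (?u @ rev ?u @ ?u @ rev ?u)"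
    using contains_rotate[of "[c]" "c # g @ d # d # rev g @ c # c # g @ d # d # rev g"] by simp
  then have "D.contains (?u @ rev ?u @ ?u @ rev ?u)"
    using contains_pi_iff[OF du] D.contains_pi_iff[OF du] pi_transfer[of "length ?u"] by simp
  then have "D.contains ((d # d # rev g @ c # c # g @ [d]) @ (d # rev g @ c # c # g))"
    using D.contains_rotate[of "c # g" "d # d # rev g @ c # c # g @ d # d # rev g @ [c]"] by simp
  moreover have "D.contains (rev (d # rev g @ c # c # g) @ (d # x @ c # c # rev y))"
    using D.contains_rotate[of "c # c # g @ d # d # x @ c # c # rev y" "rev g"] short by simp
  ultimately have "D.contains ((d # d # rev g @ c # c # g @ [d]) @ (d # x @ c # c # rev y))"
    by (rule D.contains_glue) auto
  then show ?thesis
    using D.contains_rotate[of "d # d # rev g" "c # c # g @ d # d # x @ c # c # rev y"] by simp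
qed

text \<open>The induction step for a turn whose letter returns: \<open>shorter\<close> is the
  hypothesis for shorter words, \<open>nearer\<close> the one for equal length and a smaller
  distance from a turn to the next occurrence of its letter. Rotation and reversal bring a better
  turn to the front if there is one; otherwise the word is glued with its mirror image.\<close>

lemma contains_transfer_step:
  assumes w: "contains (c # c # x @ c # y)" and cx: "c \<notin> set x"
    and shorter: "\<And>v. length v < length (c # c # x @ c # y) \<Longrightarrow> contains v \<Longrightarrow> D.contains v"
    and nearer: "\<And>b u v. contains (b # b # u @ b # v) \<Longrightarrow> b \<notin> set u \<Longrightarrow> length u < length x \<Longrightarrow>
      length (b # b # u @ b # v) = length (c # c # x @ c # y) \<Longrightarrow> D.contains (b # b # u @ b # v)"
  shows "D.contains (c # c # x @ c # y)"
proof -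
  have "contains (c # x @ c # y @ [c])" using contains_rotate[of "[c]" "c # x @ c # y"] w by simp
  from red_between_equal_letters[OF this cx] have redx: "red x = []" .
  \<comment> \<open>Three copies of \<open>c\<close> are visible and the total is even, so
    \<open>y\<close> contains another one.\<close>
  have "even (count_list (c # c # x @ c # y) c)"
    using red_eq_Nil[OF w] even_count_list_red[of "c # c # x @ c # y" c] by simp
  then have cy: "c \<in> set y" using cx by (cases "c \<in> set y") simp_all
  then obtain e z where y: "y = e @ c # z" and cz: "c \<notin> set z" using split_list_last[of c y] by blast
  show ?thesis
  \<comment> \<open>Read backwards from the turn, the next \<open>c\<close> comes after
    \<open>rev z\<close>. If that is no improvement, \<open>x\<close> is shorter than
    \<open>y\<close>, which later bounds the length of the mirrored word.\<close>
  proof (cases "length z < length x")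
    case True
    have "contains (c # c # rev z @ c # rev e @ c # rev x)"
      using contains_rotate[of "rev z @ c # rev e @ c # rev x" "[c, c]"] contains_rev[OF w] y by simp
    then have "D.contains (c # c # rev z @ c # rev e @ c # rev x)"
      using nearer True cz y by simp
    then show ?thesis
      using D.contains_rev[of "c # c # rev z @ c # rev e @ c # rev x"] y
        D.contains_rotate[of "x @ c # y" "[c, c]"] by simp
  next
    case False
    then have len: "length x < length y" using y by simp
    show ?thesis
    proof (cases "x = []")
      case True
      then have "contains (c # y)" using contains_cancel[of "[]" c "c # y"] w by simp
      then have "D.contains (c # y)" using shorter by simp
      then show ?thesis using D.contains_triple[of "[]"] True by simp
    next
      case False
      then have "\<not> distinct_adj x" using redx red_eq_self[of x] by auto
      then obtain g d x2 where x: "x = g @ d # d # x2" and adj: "distinct_adj (g @ [d])"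
        by (rule first_repetition)
      have cd: "c \<noteq> d" "c \<notin> set g" using cx x by auto
      show ?thesis
      \<comment> \<open>A further \<open>d\<close> in \<open>x\<close> is closer to the turn at
        \<open>d\<close> than the next \<open>c\<close> is to the turn at \<open>c\<close>, forwards
        or, after reversal, backwards.\<close>
      proof (cases "d \<in> set g \<or> d \<in> set x2")
        case True
        then show ?thesis
        proof
          assume "d \<in> set x2"
          then obtain a b where x2: "x2 = a @ d # b" and da: "d \<notin> set a"
            using split_list_first[of d x2] by blast
          have "contains (d # d # a @ d # b @ c # y @ c # c # g)"
            using contains_rotate[of "c # c # g" "d # d # a @ d # b @ c # y"] w x x2 by simp
          then have "D.contains (d # d # a @ d # b @ c # y @ c # c # g)"
            using nearer da x x2 by simp
          then show ?thesis
            using D.contains_rotate[of "d # d # a @ d # b @ c # y" "c # c # g"] x x2 by simp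
        next
          assume "d \<in> set g"
          then obtain a b where g: "g = a @ d # b" and db: "d \<notin> set b"
            using split_list_last[of d g] by blast
          let ?v = "rev a @ c # c # rev y @ c # rev x2"
          have "contains (d # d # rev b @ d # ?v)"
            using contains_rotate[of "rev y @ c # rev x2" "d # d # rev b @ d # rev a @ [c, c]"]
              contains_rev[OF w] x g by simp
          then have "D.contains (d # d # rev b @ d # ?v)"
            using nearer db x g by simp
          then show ?thesis
            using D.contains_rev[of "d # d # rev b @ d # ?v"] x g
              D.contains_rotate[of "x2 @ c # y" "c # c # a @ d # b @ [d, d]"] by simp
        qed
      next
        case False
        then have dg: "d \<notin> set g" "d \<notin> set x2" by simp_all
        show ?thesis
        proof (cases "d \<in> set y")
          case False
          have "contains (c # c # g @ x2 @ c # y)"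
            using contains_cancel[of "c # c # g" d "x2 @ c # y"] w x by simp
          then have "D.contains ((c # c # g) @ x2 @ c # y)" using shorter x by simp
          moreover have "set [d, d] \<inter> set ((c # c # g) @ x2 @ c # y) = {}"
            using dg False cd by auto
          ultimately show ?thesis
            using D.contains_insert[of "c # c # g" "x2 @ c # y" "[d, d]"] D.contains_pair x by simp
        next
          case dy: True
          define N where "N = Suc (Max (set (c # x @ y)))"
          have N: "a < N" if "a \<in> set (c # x @ y)" for a
            unfolding N_def less_Suc_eq_le using that by (intro Max_ge) auto
          \<comment> \<open>Gluing along \<^term>\<open>y\<close> keeps only the letters of \<^term>\<open>y\<close> common to \<^term>\<open>x\<close> and its mirror image.\<close>
          define h where "h a = (if a \<in> set y then a else a + N)" for a
          have hy: "map h y = y" "h c = c" "h d = d"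
            using cy dy by (auto simp: h_def intro: map_idI)
          have hx: "h a \<in> set y \<or> h a \<notin> set (c # x @ y)" for a using N by (auto simp: h_def)
          have inj: "inj_on h A" if "A \<subseteq> set (c # x @ y)" for A
            using that N by (fastforce simp: inj_on_def h_def)
          let ?x = "map h x"
          have "inj_on h (set (c # c # x @ c # y))" by (rule inj) auto
          then have "contains (map h (c # c # x @ c # y))" by (rule contains_map[OF w])
          then have w': "contains (c # c # ?x @ c # y)" by (simp add: hy)
          have "contains (c # ?x @ c # y @ [c])" using contains_rotate[of "[c]" "c # ?x @ c # y"] w' by simp
          moreover have cx': "c \<notin> set ?x"
            using cx cy N[of c] by (auto simp: h_def)
          ultimately have redx': "red ?x = []" by (rule red_between_equal_letters)
          have "contains (c # c # x @ c # c # rev ?x @ [c, c])"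
          proof -
            have "contains (rev y @ c # rev ?x @ [c, c])" using contains_rev[OF w'] by simp
            moreover have "set (c # c # x @ [c]) \<inter> set (c # rev ?x @ [c, c]) \<subseteq> set y"
              using cy hx by auto
            ultimately show ?thesis using contains_glue[of "c # c # x @ [c]" y "c # rev ?x @ [c, c]"] w by simp
          qed
          then have "contains (c # c # x @ c # c # rev ?x)"
            using contains_rotate[of "c # c # x @ c # c # rev ?x" "[c, c]"]
              contains_cancel[of "[]" c "c # c # x @ c # c # rev ?x"] by simp
          then have v: "contains (c # c # g @ d # d # x2 @ c # c # rev (map h x2) @ d # d # rev (map h g))"
            using x hy by simp
          \<comment> \<open>Around the cycle, \<open>rev (map h g) @ c # c # g\<close> stands
            between the mirrored and the original turn at \<open>d\<close> and contains no
            \<open>d\<close>, so it reduces to the empty word. As \<open>g\<close> is reduced, the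
            renaming fixes it.\<close>
          have hg: "map h g = g"
          proof -
            let ?g = "rev (map h g) @ c # c # g"
            have "contains (d # ?g @ d # d # x2 @ c # c # rev (map h x2) @ [d])"
              using contains_rotate[of "c # c # g @ d # d # x2 @ c # c # rev (map h x2) @ [d]"
                  "d # rev (map h g)"] v by simp
            moreover have "d \<notin> set ?g" using dg cd dy N[of d] by (auto simp: h_def)
            ultimately have "red ?g = []" by (rule red_between_equal_letters)
            then have "red g = red (map h g)"
              using red_append_Nil_right[of "rev (map h g)" g] by (simp add: red_cancel)
            moreover have "red (map h g) = map h (red g)" by (rule red_map[OF inj]) (use x in auto)
            moreover have "red g = g" using adj by (simp add: red_eq_self distinct_adj_append_iff)
            ultimately show ?thesis by simp
          qed
          have "contains (c # c # g @ d # d # x2 @ c # c # rev (map h x2) @ rev g)"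
            using contains_cancel[of "c # c # g @ d # d # x2 @ c # c # rev (map h x2)" d "rev g"] v hg by simp
          \<comment> \<open>By \<open>len\<close>, the mirrored word is at most as long as the
            original one, hence strictly shorter once its second turn at \<open>d\<close> is
            deleted.\<close>
          then have "D.contains (c # c # g @ d # d # x2 @ c # c # rev (map h x2) @ rev g)"
            using shorter len x by simp
          then have "D.contains (c # c # g @ d # d # x2 @ c # c # rev (map h x2) @ d # d # rev g)"
            using v redx redx' adj cd dg
            by (intro restore_mirrored_turn) (simp_all add: hg hy x red_cancel distinct_adj_append_iff)
          then have "D.contains ((c # c # x @ [c]) @ (c # rev ?x))" using x hg hy by simp
          moreover have "D.contains (rev (c # rev ?x) @ y)"
          proof -
            have "contains (?x @ c # y)" using contains_cancel[of "[]" c "?x @ c # y"] w' by simp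
            then show ?thesis using shorter by simp
          qed
          \<comment> \<open>Letters of \<open>x\<close> that occur in \<open>y\<close> are fixed by
            \<open>h\<close> and therefore occur in \<open>?x\<close>.\<close>
          moreover have "set (c # c # x @ [c]) \<inter> set y \<subseteq> set (c # rev ?x)"
            by (force simp: h_def)
          ultimately show ?thesis using D.contains_glue[of "c # c # x @ [c]" "c # rev ?x" y] by simp
        qed
      qed
    qed
  qed
qed

text \<open>The outer induction is on the length, the inner one on the distance from a turn to the
  next occurrence of its letter. A nonempty word of \<open>C\<close> reduces to the empty word and
  so has a turn, which is rotated to the front. If its letter does not return, the turn is a block
  of its own and can be split off.\<close>

lemma contains_transfer: "contains w \<Longrightarrow> D.contains w"
proof (induction w rule: length_induct)
  case (1 w)
  note shorter = "1.IH"
  have turn: "D.contains (c # c # x @ c # y)"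
    if "contains (c # c # x @ c # y)" "c \<notin> set x" "length (c # c # x @ c # y) = length w" for c x y
    using that
  proof (induction x arbitrary: c y rule: length_induct)
    case (1 x)
    show ?case
    proof (rule contains_transfer_step[OF "1.prems"(1,2)])
      show "D.contains v" if "length v < length (c # c # x @ c # y)" "contains v" for v
        using shorter that "1.prems"(3) by simp
      show "D.contains (b # b # u @ b # v)"
        if "contains (b # b # u @ b # v)" "b \<notin> set u" "length u < length x"
          "length (b # b # u @ b # v) = length (c # c # x @ c # y)" for b u v
        using "1.IH" that "1.prems"(3) by simp
    qed
  qed
  show ?case
  proof (cases "w = []")
    case True
    then show ?thesis using D.contains_cancel[of "[]" _ "[]"] D.contains_pair by simp
  next
    case False
    then have "\<not> distinct_adj w" using red_eq_Nil[OF "1.prems"] red_eq_self[of w] by auto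
    then obtain u a v where w: "w = u @ a # a # v" by (rule first_repetition)
    have rot: "contains (a # a # v @ u)" using contains_rotate[of u "a # a # v"] "1.prems" w by simp
    have "D.contains (a # a # v @ u)"
    proof (cases "a \<in> set (v @ u)")
      case True
      then obtain x y where xy: "v @ u = x @ a # y" "a \<notin> set x" by (blast dest: split_list_first)
      have "length (a # a # x @ a # y) = length w"
        using arg_cong[OF xy(1), of length] w by simp
      then show ?thesis using turn[of a x y] rot xy by simp
    next
      case False
      have "contains (v @ u)" using contains_cancel[of "[]" a "v @ u"] rot by simp
      then have "D.contains (v @ u)" using "1.IH" w by simp
      then show ?thesis using D.contains_append[OF D.contains_pair, of "v @ u" a] False by simp
    qed
    then show ?thesis using D.contains_rotate[of "a # a # v" u] w by simp
  qed
qed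

lemma subset_category: "C \<subseteq> D"
proof
  fix p assume p: "p \<in> C"
  then obtain u v :: "nat list" where "p = two_row u v"
    using partition_as_two_row sub_all_partitions by blast
  then show "p \<in> D" using p two_row_in_iff D.two_row_in_iff contains_transfer by simp
qed

end

section \<open>Generation by the partitions \<open>pi_partition j\<close>\<close>

lemma pi_partition_1: "pi_partition 1 = four_block"
  using word_partition_map[of "\<lambda>_. 0 :: nat" "[1, 1, 1, 1 :: nat]"]
  by (simp add: pi_partition_def four_block_def)

text \<open>\<open>J\<close> collects the indices of the \<open>pi_partition j\<close> in
  \<open>C\<close>. As \<open>1 \<in> J\<close> supplies the four block partition, every category
  containing these partitions can be compared with \<open>C\<close> and includes it.\<close>

lemma (in hyperoctahedral_category) eq_generated_category:
  assumes J: "1 \<in> J" "\<And>j. j \<in> J \<Longrightarrow> 1 \<le> j" "\<And>j. 1 \<le> j \<Longrightarrow> pi_partition j \<in> C \<longleftrightarrow> j \<in> J"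
  shows "C = generated_category (pi_partition ` J)"
proof
  show "C \<subseteq> generated_category (pi_partition ` J)"
    unfolding generated_category_def hull_def
  proof (rule Inter_greatest)
    fix D assume "D \<in> {t. partition_category t \<and> pi_partition ` J \<subseteq> t}"
    then have D: "partition_category D" "pi_partition ` J \<subseteq> D" by simp_all
    then have "four_block \<in> D" using J(1) pi_partition_1 by force
    then interpret pi_comparison C D using D J by unfold_locales auto
    show "C \<subseteq> D" by (rule subset_category)
  qed
  show "generated_category (pi_partition ` J) \<subseteq> C"
    unfolding generated_category_def using partition_category J by (intro hull_minimal) auto
qed

theorem theorem1:
  fixes C :: "partition set"
  assumes "partition_category C"
    and "hyperoctahedral C"
    and "\<not> group_theoretical C"
  shows "(\<exists>k\<ge>1. C = generated_category (pi_partition ` {1..k})) \<or>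
         C = generated_category (pi_partition ` {1..})"
proof -
  interpret hyperoctahedral_category C
    using assms by unfold_locales (simp_all add: hyperoctahedral_def group_theoretical_def)
  show ?thesis
  proof (cases "\<forall>j\<ge>1. pi_partition j \<in> C")
    case True
    then have "C = generated_category (pi_partition ` {1..})" by (intro eq_generated_category) auto
    then show ?thesis ..
  next
    case False
    \<comment> \<open>The least missing index. It is at least 2, as \<open>pi_partition 1\<close> is
      the four block partition, and by antimonotonicity the indices present are exactly those below
      it.\<close>
    define m where "m = (LEAST j. pi_partition j \<notin> C \<and> 1 \<le> j)"
    have m: "pi_partition m \<notin> C" "1 \<le> m"
      using False LeastI_ex[of "\<lambda>j. pi_partition j \<notin> C \<and> 1 \<le> j"] by (auto simp: m_def)
    have less: "pi_partition j \<in> C" if "1 \<le> j" "j < m" for j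
      using not_less_Least[of j "\<lambda>j. pi_partition j \<notin> C \<and> 1 \<le> j"] that by (auto simp: m_def)
    have "m \<noteq> 1" using m four_block_in pi_partition_1 by metis
    with m(2) have m2: "2 \<le> m" by simp
    have iff: "pi_partition j \<in> C \<longleftrightarrow> j \<in> {1..m - 1}" if "1 \<le> j" for j
    proof (cases "j < m")
      case True
      then show ?thesis using less that by auto
    next
      case False
      then show ?thesis using pi_partition_antimono[of j m] m by auto
    qed
    have "C = generated_category (pi_partition ` {1..m - 1})"
      using m2 by (intro eq_generated_category iff) auto
    then show ?thesis using m2 by (intro disjI1 exI[of _ "m - 1"]) simp
  qed
qed

end
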